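(* Let $X$ be a separable complex Banach space and let $T$ be a bounded linear operator on $X$. Suppose that there exist a sequence $(\lambda_n)_{n\in\mathbb{N}}\subset\mathbb{C}\setminus\{0\}$ with $|\lambda_n|\le 1$ for all $n\in\mathbb{N}$, two dense sets $D_1,D_2\subset X$, and a sequence of maps $S_n:D_2\to X$ such that, as $n\to\infty$: 1. $\lambda_nT^nx\to 0$ for all $x\in D_1$; 2. $\frac{1}{\lambda_n}S_ny\to 0$ for all $y\in D_2$; 3. $T^nS_ny\to y$ for all $y\in D_2$. Then $T$ is compound.
   Context: $\mathbb{D}=\{z\in\mathbb{C}:|z|\le 1\}$ is the closed unit disk; $\mathbb{N}$ is the set of positive integers. The maps $S_n$ are not assumed linear or continuous. Definition (compound): a bounded linear operator $T$ on $X$ is compound if for all nonempty open sets $U,V\subset X$ there exist $N\in\mathbb{N}$ and a sequence $(\alpha_n)\subset\mathbb{D}\setminus\{0\}$ such that $T^n(\alpha_nU)\cap V\neq\emptyset$ for all $n\ge N$. *)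

theory Defs
  imports "HOL-Analysis.Analysis"
begin

text \<open>
  HOL-Analysis only provides real Banach spaces as a type class.  A complex Banach space is
  a \<open>banach\<close> space with a complex scalar multiplication that extends the real one and for
  which the given norm is absolutely homogeneous.
\<close>

class scaleC = scaleR +
  fixes scaleC :: "complex \<Rightarrow> 'a \<Rightarrow> 'a" (infixr \<open>*\<^sub>C\<close> 75)
  assumes scaleR_scaleC: "r *\<^sub>R x = complex_of_real r *\<^sub>C x"

class complex_vector = scaleC + ab_group_add +
  assumes scaleC_add_right: "a *\<^sub>C (x + y) = a *\<^sub>C x + a *\<^sub>C y"
    and scaleC_add_left: "(a + b) *\<^sub>C x = a *\<^sub>C x + b *\<^sub>C x"
    and scaleC_scaleC: "a *\<^sub>C b *\<^sub>C x = (a * b) *\<^sub>C x"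
    and scaleC_one: "1 *\<^sub>C x = x"

class complex_banach = complex_vector + banach +
  assumes norm_scaleC: "norm (a *\<^sub>C x) = cmod a * norm x"

instantiation complex :: complex_banach
begin

definition scaleC_complex :: "complex \<Rightarrow> complex \<Rightarrow> complex" where
  "scaleC_complex a x = a * x"

instance
  by standard
    (simp_all add: scaleC_complex_def scaleR_conv_of_real algebra_simps norm_mult)

end

global_interpretation complex_vector: vector_space "scaleC :: complex \<Rightarrow> 'a \<Rightarrow> 'a :: complex_vector"
  by standard (simp_all add: scaleC_add_right scaleC_add_left scaleC_scaleC scaleC_one)

definition bounded_clinear :: "('a::complex_banach \<Rightarrow> 'b::complex_banach) \<Rightarrow> bool" where
  "bounded_clinear T \<longleftrightarrow>
     Vector_Spaces.linear scaleC scaleC T \<and> (\<exists>K. \<forall>x. norm (T x) \<le> norm x * K)"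

text \<open>
  Sequences are indexed by the positive integers, so the value of \<open>\<alpha>\<close> at \<open>0\<close> is irrelevant.
  The \<open>n\<close>-th power of \<open>T\<close> is the function iterate \<open>T ^^ n\<close>.
\<close>

definition compound :: "('a::complex_banach \<Rightarrow> 'a) \<Rightarrow> bool" where
  "compound T \<longleftrightarrow>
     (\<forall>U V. open U \<and> U \<noteq> {} \<and> open V \<and> V \<noteq> {} \<longrightarrow>
       (\<exists>N\<ge>1. \<exists>\<alpha> :: nat \<Rightarrow> complex.
          (\<forall>n\<ge>1. \<alpha> n \<in> cball 0 1 - {0}) \<and>
          (\<forall>n\<ge>N. (T ^^ n) ` ((\<lambda>x. \<alpha> n *\<^sub>C x) ` U) \<inter> V \<noteq> {})))"

end

theory Submission
  imports Defs
begin

text \<open>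
  For \<open>x \<in> U \<inter> D1\<close> and \<open>y \<in> V \<inter> D2\<close>, the points \<open>z\<^sub>n = x + (1 / \<lambda>\<^sub>n) S\<^sub>n y\<close> converge to \<open>x\<close> while
  \<open>T\<^sup>n (\<lambda>\<^sub>n z\<^sub>n) = \<lambda>\<^sub>n T\<^sup>n x + T\<^sup>n S\<^sub>n y\<close> converges to \<open>y\<close>, so \<open>\<alpha>\<^sub>n = \<lambda>\<^sub>n\<close> is a suitable choice.
\<close>

lemma funpow_add_distrib:
  fixes T :: "'a::plus \<Rightarrow> 'a"
  assumes "\<And>x y. T (x + y) = T x + T y"
  shows "(T ^^ n) (x + y) = (T ^^ n) x + (T ^^ n) y"
  by (induction n) (simp_all add: assms)

lemma funpow_scaleC_distrib:
  fixes T :: "'a::scaleC \<Rightarrow> 'a"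
  assumes "\<And>c x. T (c *\<^sub>C x) = c *\<^sub>C T x"
  shows "(T ^^ n) (c *\<^sub>C x) = c *\<^sub>C (T ^^ n) x"
  by (induction n) (simp_all add: assms)

theorem theorem2p13:
  fixes T :: "'a::complex_banach \<Rightarrow> 'a"
    and lam :: "nat \<Rightarrow> complex"
    and D1 D2 :: "'a set"
    and S :: "nat \<Rightarrow> 'a \<Rightarrow> 'a"
  assumes "separable_space (euclidean :: 'a topology)"
    and "bounded_clinear T"
    and "\<And>n. n \<ge> 1 \<Longrightarrow> lam n \<noteq> 0"
    and "\<And>n. n \<ge> 1 \<Longrightarrow> cmod (lam n) \<le> 1"
    and "closure D1 = UNIV"
    and "closure D2 = UNIV"
    and "\<And>x. x \<in> D1 \<Longrightarrow> (\<lambda>n. lam n *\<^sub>C (T ^^ n) x) \<longlonglongrightarrow> 0"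
    and "\<And>y. y \<in> D2 \<Longrightarrow> (\<lambda>n. (1 / lam n) *\<^sub>C S n y) \<longlonglongrightarrow> 0"
    and "\<And>y. y \<in> D2 \<Longrightarrow> (\<lambda>n. (T ^^ n) (S n y)) \<longlonglongrightarrow> y"
  shows "compound T"
proof -
  have lin: "Vector_Spaces.linear scaleC scaleC T"
    using assms(2) by (simp add: bounded_clinear_def)
  have Tn_add: "(T ^^ n) (x + y) = (T ^^ n) x + (T ^^ n) y" for n x y
    using lin by (intro funpow_add_distrib) (simp add: Vector_Spaces.linear_iff)
  have Tn_scale: "(T ^^ n) (c *\<^sub>C x) = c *\<^sub>C (T ^^ n) x" for n c x
    using lin by (intro funpow_scaleC_distrib) (simp add: Vector_Spaces.linear_iff)
  have "\<exists>N\<ge>1. \<exists>\<alpha>. (\<forall>n\<ge>1. \<alpha> n \<in> cball 0 1 - {0}) \<and>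
      (\<forall>n\<ge>N. (T ^^ n) ` ((\<lambda>x. \<alpha> n *\<^sub>C x) ` U) \<inter> V \<noteq> {})"
    if U: "open U" "U \<noteq> {}" and V: "open V" "V \<noteq> {}" for U V :: "'a set"
  proof -
    \<comment> \<open>Density enters here: if \<open>U\<close> missed \<open>D1\<close>, it would
      also miss \<open>closure D1\<close>, which is the whole space.\<close>
    obtain x where x: "x \<in> U" "x \<in> D1"
      using open_Int_closure_eq_empty[OF U(1), of D1] U(2) assms(5) by auto
    obtain y where y: "y \<in> V" "y \<in> D2"
      using open_Int_closure_eq_empty[OF V(1), of D2] V(2) assms(6) by auto
    define z where "z n = x + (1 / lam n) *\<^sub>C S n y" for n
    have "z \<longlonglongrightarrow> x"
      unfolding z_def using tendsto_add[OF tendsto_const assms(8)[OF y(2)]] by simp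
    \<comment> \<open>This is the expanded form of \<open>(T ^^ n) (lam n *\<^sub>C z n)\<close>.
      The two are identified only later, for \<open>n \<ge> 1\<close>, since \<open>lam 0\<close>
      may vanish; the limit does not see the index 0.\<close>
    moreover have "(\<lambda>n. lam n *\<^sub>C (T ^^ n) x + (T ^^ n) (S n y)) \<longlonglongrightarrow> y"
      using tendsto_add[OF assms(7)[OF x(2)] assms(9)[OF y(2)]] by simp
    ultimately have "\<forall>\<^sub>F n in sequentially. z n \<in> U \<and>
        lam n *\<^sub>C (T ^^ n) x + (T ^^ n) (S n y) \<in> V"
      using U(1) V(1) x(1) y(1) by (intro eventually_conj topological_tendstoD)
    then obtain N where N: "\<And>n. n \<ge> N \<Longrightarrow> z n \<in> U"
        "\<And>n. n \<ge> N \<Longrightarrow> lam n *\<^sub>C (T ^^ n) x + (T ^^ n) (S n y) \<in> V"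
      by (auto simp: eventually_sequentially)
    \<comment> \<open>The threshold \<open>N\<close> may be 0. Taking \<open>max 1 N\<close>
      guarantees \<open>lam n \<noteq> 0\<close> and meets the bound \<open>N \<ge> 1\<close> in
      \<open>compound\<close>.\<close>
    have "(T ^^ n) ` ((\<lambda>x. lam n *\<^sub>C x) ` U) \<inter> V \<noteq> {}" if n: "n \<ge> max 1 N" for n
    proof -
      \<comment> \<open>The factor \<open>1 / lam n\<close> in \<open>z n\<close> cancels, so that
        \<open>T ^^ n\<close> acts on \<open>S n y\<close> itself.\<close>
      have "lam n *\<^sub>C z n = lam n *\<^sub>C x + S n y"
        using assms(3)[of n] n by (simp add: z_def scaleC_add_right scaleC_scaleC scaleC_one)
      then have "(T ^^ n) (lam n *\<^sub>C z n) \<in> V"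
        using N(2)[of n] n by (simp add: Tn_add Tn_scale)
      then show ?thesis
        using N(1)[of n] n by auto
    qed
    moreover have "\<forall>n\<ge>1. lam n \<in> cball 0 1 - {0}"
      using assms(3,4) by auto
    ultimately show ?thesis
      by (intro exI[of _ "max 1 N"] exI[of _ lam]) auto
  qed
  then show ?thesis
    by (auto simp: compound_def)
qed

end
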